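(* Let $n = p_1^{k_1} p_2^{k_2} \cdots p_r^{k_r}$ be the prime factorization of a positive integer $n$, with distinct primes $p_i$ and integers $k_i \ge 1$, and let $D = \prod_{i=1}^r (k_i+1)$ be the number of divisors of $n$. Then the Harary index of the divisor prime graph $G_{Dp(n)}$ is $$H(G_{Dp(n)}) = \frac{D(D-1) + \prod_{i=1}^r (2k_i+1) - 1}{4}.$$
   Context: For a positive integer $n$, the divisor prime graph $G_{Dp(n)}$ is the simple graph whose vertex set is the set of positive divisors of $n$, in which two distinct vertices $x, y$ are adjacent if and only if $\gcd(x,y) = 1$ (no loops). For a connected graph $G$, $d(u,v)$ denotes the shortest-path distance, and the Harary index is $H(G) = \sum_{\{u,v\}} \frac{1}{d(u,v)}$, the sum over all unordered pairs of distinct vertices. *)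

theory Defs
  imports
    Complex_Main
    "HOL-Computational_Algebra.Primes"
    "Graph_Theory.Graph_Theory"
begin

text \<open>
  Undirected simple graphs are represented as in \<^theory>\<open>Graph_Theory.Digraph\<close>, as finite
  symmetric loop-free digraphs without parallel arcs.
\<close>

definition divisor_prime_graph :: "nat \<Rightarrow> nat pair_pre_digraph" where
  "divisor_prime_graph n =
     \<lparr> pverts = {d. d dvd n},
       parcs = {(x, y). x dvd n \<and> y dvd n \<and> x \<noteq> y \<and> gcd x y = 1} \<rparr>"

lemma pair_graph_divisor_prime_graph:
  assumes "n > 0"
  shows "pair_graph (divisor_prime_graph n)"
proof
  show "symmetric (with_proj (divisor_prime_graph n))"
    by (auto simp: symmetric_def sym_def divisor_prime_graph_def gcd.commute)
  have fin: "finite {d. d dvd n}" using assms by simp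
  show "finite (pverts (divisor_prime_graph n))"
    using fin by (simp add: divisor_prime_graph_def)
  have "{(x, y). x dvd n \<and> y dvd n \<and> x \<noteq> y \<and> gcd x y = 1} \<subseteq> {d. d dvd n} \<times> {d. d dvd n}"
    by auto
  then show "finite (parcs (divisor_prime_graph n))"
    using fin by (simp add: divisor_prime_graph_def finite_subset)
qed (auto simp: divisor_prime_graph_def)

lemma connected_divisor_prime_graph:
  assumes "n > 0"
  shows "connected (with_proj (divisor_prime_graph n))"
proof -
  interpret pair_graph "divisor_prime_graph n"
    using assms by (rule pair_graph_divisor_prime_graph)
  have to1: "u \<rightarrow>\<^sup>*\<^bsub>with_proj (divisor_prime_graph n)\<^esub> 1"
    and from1: "1 \<rightarrow>\<^sup>*\<^bsub>with_proj (divisor_prime_graph n)\<^esub> u" if "u dvd n" for u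
  proof -
    have v: "1 \<in> pverts (divisor_prime_graph n)" "u \<in> pverts (divisor_prime_graph n)"
      using that by (auto simp: divisor_prime_graph_def)
    have "u = 1 \<or> (u, 1) \<in> parcs (divisor_prime_graph n) \<and> (1, u) \<in> parcs (divisor_prime_graph n)"
      using that by (auto simp: divisor_prime_graph_def)
    then show "u \<rightarrow>\<^sup>*\<^bsub>with_proj (divisor_prime_graph n)\<^esub> 1" "1 \<rightarrow>\<^sup>*\<^bsub>with_proj (divisor_prime_graph n)\<^esub> u"
      using v by (auto intro: reachable_refl reachable_adjI)
  qed
  have "strongly_connected (with_proj (divisor_prime_graph n))"
    unfolding strongly_connected_def
    using reachable_trans[OF to1 from1]
    by (auto simp: divisor_prime_graph_def)
  then show ?thesis
    using reachable_mk_symmetricI by (auto simp: connected_def strongly_connected_def)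
qed

text \<open>
  The shortest-path distance is the library's minimum walk cost for unit arc weights.  It is
  used for connected graphs, where the minimum cost between any two vertices is finite, so that
  the conversion to a real number loses nothing.
\<close>

definition graph_dist :: "('a, 'b) pre_digraph \<Rightarrow> 'a \<Rightarrow> 'a \<Rightarrow> real" where
  "graph_dist G u v = real_of_ereal (wf_digraph.\<mu> G (\<lambda>_. 1) u v)"

text \<open>
  Every unordered pair of distinct vertices is represented once, by its increasing enumeration
  with respect to an arbitrary linear order on the vertex type.
\<close>

definition harary_index :: "('a::linorder, 'b) pre_digraph \<Rightarrow> real" where
  "harary_index G = (\<Sum>(u, v) \<in> {(u, v). u \<in> verts G \<and> v \<in> verts G \<and> u < v}. 1 / graph_dist G u v)"

end

theory Submission
  imports Defs
begin

text \<open>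
  The vertex 1 is adjacent to every other vertex, so two distinct vertices are at distance 1 if
  they are coprime and at distance 2 otherwise. Hence the Harary index is half the sum of the
  number of edges and the number of unordered pairs of distinct divisors. The number of ordered
  pairs of coprime divisors is multiplicative in \<open>n\<close> and equals \<open>2 k + 1\<close> at a prime power
  \<open>p ^ k\<close>; the only such pair on the diagonal is \<open>(1, 1)\<close>.
\<close>

section \<open>Distances in the divisor prime graph\<close>

lemma (in wf_digraph) unit_cost_eq_length: "awalk_cost (\<lambda>_. 1) p = real (length p)"
  by (induction p) auto

text \<open>The cost \<open>\<mu>\<close> is an infimum over all walks, so a walk of least length
  bounds it from above as a member and from below by minimality.\<close>

lemma (in wf_digraph) \<mu>_unit_eq_length:
  assumes "awalk u p v" and "\<And>q. awalk u q v \<Longrightarrow> length p \<le> length q"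
  shows "\<mu> (\<lambda>_. 1) u v = ereal (real (length p))"
proof (rule antisym)
  show "\<mu> (\<lambda>_. 1) u v \<le> ereal (real (length p))"
    using min_cost_le_walk_cost[OF assms(1), of "\<lambda>_. 1"] by (simp add: unit_cost_eq_length)
  show "ereal (real (length p)) \<le> \<mu> (\<lambda>_. 1) u v"
    unfolding \<mu>_def by (rule INF_greatest) (simp add: unit_cost_eq_length assms(2))
qed

lemma graph_dist_divisor_prime_graph:
  assumes "n > 0" "u dvd n" "v dvd n" "u \<noteq> v"
  shows "graph_dist (with_proj (divisor_prime_graph n)) u v = (if coprime u v then 1 else 2)"
proof -
  interpret pair_graph "divisor_prime_graph n"
    using assms(1) by (rule pair_graph_divisor_prime_graph)
  have arc_iff: "(x, y) \<in> parcs (divisor_prime_graph n)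
      \<longleftrightarrow> x dvd n \<and> y dvd n \<and> x \<noteq> y \<and> coprime x y" for x y
    by (auto simp: divisor_prime_graph_def coprime_iff_gcd_eq_1)
  have vert_iff: "x \<in> pverts (divisor_prime_graph n) \<longleftrightarrow> x dvd n" for x
    by (auto simp: divisor_prime_graph_def)
  \<comment> \<open>The empty walk would force \<open>u = v\<close>.\<close>
  have nonempty: "length q \<ge> 1" if "awalk u q v" for q
    using that assms(4) by (cases q) (auto simp: awalk_simps)
  show ?thesis
  proof (cases "coprime u v")
    case True
    have "awalk u [(u, v)] v"
      using True assms by (simp add: awalk_simps arc_iff vert_iff)
    from \<mu>_unit_eq_length[OF this] nonempty True show ?thesis
      by (simp add: graph_dist_def)
  next
    case False
    \<comment> \<open>Arcs exclude loops, so the detour through 1 is a walk only if neither end is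
      1.\<close>
    then have "u \<noteq> 1" "v \<noteq> 1" by auto
    then have walk: "awalk u [(u, 1), (1, v)] v"
      using assms by (simp add: awalk_simps arc_iff vert_iff)
    have "length q \<ge> 2" if q: "awalk u q v" for q
    proof (rule ccontr)
      assume "\<not> length q \<ge> 2"
      with nonempty[OF q] have "length q = 1" by simp
      \<comment> \<open>A walk with a single arc would make \<open>u\<close> and \<open>v\<close>
        adjacent, hence coprime.\<close>
      then obtain e where "q = [e]" by (auto simp: length_Suc_conv)
      with q False show False by (cases e) (auto simp: awalk_simps arc_iff)
    qed
    then have "\<mu> (\<lambda>_. 1) u v = ereal (real (length [(u, 1), (1, v)]))"
      by (intro \<mu>_unit_eq_length[OF walk]) (simp add: numeral_2_eq_2)
    with False show ?thesis by (simp add: graph_dist_def)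
  qed
qed

section \<open>Multiplicativity of the divisor counts\<close>

definition coprime_divisor_pairs :: "nat \<Rightarrow> (nat \<times> nat) set" where
  "coprime_divisor_pairs n = {(x, y). x dvd n \<and> y dvd n \<and> coprime x y}"

lemma finite_coprime_divisor_pairs:
  assumes "n > 0"
  shows "finite (coprime_divisor_pairs n)"
  by (rule finite_subset[of _ "{d. d dvd n} \<times> {d. d dvd n}"])
    (use assms in \<open>auto simp: coprime_divisor_pairs_def\<close>)

text \<open>The factor \<open>y\<close> is coprime to \<open>a\<close>, so it drops out of the gcd.
  With its mirror image this inverts the multiplication of divisors of \<open>a\<close> and
  \<open>b\<close>.\<close>

lemma gcd_mult_dvd_left:
  fixes a b x y :: nat
  assumes "coprime a b" "x dvd a" "y dvd b"
  shows "gcd (x * y) a = x"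
proof -
  have "coprime a y" using assms by (meson coprime_divisors dvd_refl)
  then have "gcd (x * y) a = gcd x a"
    by (simp add: gcd_mult_right_right_cancel gcd_mult_left_right_cancel)
  with assms show ?thesis by (simp add: gcd_nat.absorb1)
qed

lemma gcd_mult_dvd_right:
  fixes a b x y :: nat
  assumes "coprime a b" "x dvd a" "y dvd b"
  shows "gcd (x * y) b = y"
  using gcd_mult_dvd_left[of b a y x] assms by (simp add: coprime_commute mult.commute)

lemma bij_betw_divisors_mult:
  fixes a b :: nat
  assumes "coprime a b"
  shows "bij_betw (\<lambda>(x, y). x * y) ({d. d dvd a} \<times> {d. d dvd b}) {d. d dvd a * b}"
proof (rule bij_betw_byWitness[where f' = "\<lambda>d. (gcd d a, gcd d b)"])
  have "gcd d a * gcd d b = d" if "d dvd a * b" for d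
  proof -
    \<comment> \<open>Some factorization of \<open>d\<close> along \<open>a\<close> and
      \<open>b\<close> exists; the two gcds then recover its factors.\<close>
    obtain x y where "d = x * y" "x dvd a" "y dvd b"
      using \<open>d dvd a * b\<close> division_decomp by blast
    with assms show ?thesis by (simp add: gcd_mult_dvd_left gcd_mult_dvd_right)
  qed
  then show "\<forall>d\<in>{d. d dvd a * b}. (\<lambda>(x, y). x * y) (gcd d a, gcd d b) = d" by simp
qed (use assms in \<open>auto simp: gcd_mult_dvd_left gcd_mult_dvd_right mult_dvd_mono\<close>)

lemma card_divisors_mult:
  fixes a b :: nat
  assumes "coprime a b"
  shows "card {d. d dvd a * b} = card {d. d dvd a} * card {d. d dvd b}"
  using bij_betw_same_card[OF bij_betw_divisors_mult[OF assms]]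
  by (simp add: card_cartesian_product)

text \<open>The correspondence between divisors of \<open>a * b\<close> and pairs of divisors is
  applied in each coordinate. The pair \<open>(1, 1)\<close> counts here although it is no edge;
  without it the count would not be multiplicative.\<close>

lemma card_coprime_divisor_pairs_mult:
  assumes ab: "coprime a b"
  shows "card (coprime_divisor_pairs (a * b)) =
    card (coprime_divisor_pairs a) * card (coprime_divisor_pairs b)"
proof -
  let ?f = "\<lambda>((x, y), (x', y')). (x * x', y * y') :: nat \<times> nat"
  let ?g = "\<lambda>(x, y). ((gcd x a, gcd y a), (gcd x b, gcd y b))"
  \<comment> \<open>Settles the cross terms: a divisor of \<open>a\<close> in one coordinate against
    a divisor of \<open>b\<close> in the other.\<close>
  have cop: "coprime u v" if "u dvd a" "v dvd b" for u v
    using ab that by (meson coprime_divisors)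
  have gcd_eq: "gcd x a * gcd x b = x" if x: "x dvd a * b" for x
  proof -
    obtain u v where "x = u * v" "u dvd a" "v dvd b"
      using x division_decomp by blast
    with ab show ?thesis by (simp add: gcd_mult_dvd_left gcd_mult_dvd_right)
  qed
  have "bij_betw ?f (coprime_divisor_pairs a \<times> coprime_divisor_pairs b)
      (coprime_divisor_pairs (a * b))"
  proof (rule bij_betw_byWitness[where f' = ?g])
    show "\<forall>z\<in>coprime_divisor_pairs a \<times> coprime_divisor_pairs b. ?g (?f z) = z"
      using ab by (auto simp: coprime_divisor_pairs_def gcd_mult_dvd_left gcd_mult_dvd_right)
    show "\<forall>z\<in>coprime_divisor_pairs (a * b). ?f (?g z) = z"
      by (auto simp: coprime_divisor_pairs_def gcd_eq)
    show "?f ` (coprime_divisor_pairs a \<times> coprime_divisor_pairs b)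
        \<subseteq> coprime_divisor_pairs (a * b)"
      using cop by (auto simp: coprime_divisor_pairs_def mult_dvd_mono coprime_commute)
    show "?g ` coprime_divisor_pairs (a * b)
        \<subseteq> coprime_divisor_pairs a \<times> coprime_divisor_pairs b"
      by (auto simp: coprime_divisor_pairs_def intro: coprime_divisors[OF gcd_dvd1 gcd_dvd1])
  qed
  from bij_betw_same_card[OF this] show ?thesis by (simp add: card_cartesian_product)
qed

section \<open>Prime powers and their products\<close>

lemma divisors_prime_power:
  fixes p :: nat
  assumes "prime p"
  shows "{d. d dvd p ^ k} = (\<lambda>i. p ^ i) ` {..k}"
  using divides_primepow_nat[OF assms] by auto

lemma inj_on_prime_power:
  fixes p :: nat
  assumes "prime p"
  shows "inj_on (\<lambda>i. p ^ i) A"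
  using prime_gt_1_nat[OF assms] by (auto intro: inj_onI)

lemma card_divisors_prime_power:
  fixes p :: nat
  assumes "prime p"
  shows "card {d. d dvd p ^ k} = k + 1"
  by (simp add: divisors_prime_power assms card_image inj_on_prime_power)

lemma card_coprime_divisor_pairs_prime_power:
  assumes p: "prime p"
  shows "card (coprime_divisor_pairs (p ^ k)) = 2 * k + 1"
proof -
  have cop: "coprime (p ^ i) (p ^ j) \<longleftrightarrow> i = 0 \<or> j = 0" for i j
    using p by auto
  \<comment> \<open>One of the two exponents must vanish. The exponents in \<open>?B\<close> start
    at 1, so that \<open>(1, 1)\<close> is counted only in \<open>?A\<close>.\<close>
  let ?A = "(\<lambda>i. (p ^ i, 1 :: nat)) ` {..k}" and ?B = "(\<lambda>j. (1 :: nat, p ^ j)) ` {1..k}"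
  have eq: "coprime_divisor_pairs (p ^ k) = ?A \<union> ?B"
  proof
    show "coprime_divisor_pairs (p ^ k) \<subseteq> ?A \<union> ?B"
    proof clarify
      fix x y
      assume xy: "(x, y) \<in> coprime_divisor_pairs (p ^ k)" and "(x, y) \<notin> ?B"
      from xy obtain i j where ij: "i \<le> k" "j \<le> k" "x = p ^ i" "y = p ^ j"
        using p by (auto simp: coprime_divisor_pairs_def divides_primepow_nat)
      with xy have "i = 0 \<or> j = 0"
        using cop[of i j]
        by (simp add: coprime_divisor_pairs_def
            del: coprime_power_left_iff coprime_power_right_iff)
      with ij \<open>(x, y) \<notin> ?B\<close> show "(x, y) \<in> ?A"
        by (cases "j = 0") (auto simp: image_iff)
    qed
    show "?A \<union> ?B \<subseteq> coprime_divisor_pairs (p ^ k)"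
      by (auto simp: coprime_divisor_pairs_def le_imp_power_dvd)
  qed
  have "1 \<noteq> p ^ j" if "j \<ge> 1" for j
    using one_less_power[OF prime_gt_1_nat[OF p], of j] that by simp
  then have "?A \<inter> ?B = {}" by fastforce
  moreover have "card ?A = k + 1" "card ?B = k"
    using prime_gt_1_nat[OF p] by (auto simp: card_image inj_on_def)
  ultimately show ?thesis
    unfolding eq by (simp add: card_Un_disjoint)
qed

text \<open>A new prime differs from all earlier ones, so its power is coprime to their product. A
  general \<open>f\<close> serves both the divisors and the coprime pairs.\<close>

lemma multiplicative_prod_prime_powers:
  fixes p k :: "'i \<Rightarrow> nat" and f :: "nat \<Rightarrow> nat"
  assumes "\<And>a b. coprime a b \<Longrightarrow> f (a * b) = f a * f b" and "f 1 = 1"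
    and "finite I" "inj_on p I" "\<And>i. i \<in> I \<Longrightarrow> prime (p i)"
  shows "f (\<Prod>i\<in>I. p i ^ k i) = (\<Prod>i\<in>I. f (p i ^ k i))"
  using assms(3-5)
proof (induction I rule: finite_induct)
  case empty
  then show ?case using assms(2) by simp
next
  case (insert i I)
  have "coprime (p i ^ k i) (\<Prod>j\<in>I. p j ^ k j)"
  proof (rule prod_coprime_right)
    fix j assume "j \<in> I"
    with insert have "p i \<noteq> p j" "prime (p i)" "prime (p j)"
      by (auto simp: inj_on_def)
    then show "coprime (p i ^ k i) (p j ^ k j)"
      by (simp add: primes_coprime)
  qed
  with insert assms(1) show ?case by simp
qed

section \<open>From ordered pairs to the Harary index\<close>

lemma card_symmetric_pairs:
  fixes S :: "('a::linorder \<times> 'a) set"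
  assumes "finite S" "sym S"
  shows "card S = 2 * card {(x, y) \<in> S. x < y} + card {x. (x, x) \<in> S}"
proof -
  let ?L = "{(x, y) \<in> S. x < y}" and ?R = "{(x, y) \<in> S. y < x}" and ?E = "{(x, y) \<in> S. x = y}"
  have fin: "finite ?L" "finite ?R" "finite ?E"
    by (rule finite_subset[OF _ assms(1)]; auto)+
  \<comment> \<open>By symmetry, swapping coordinates exchanges the two sides of the
    diagonal.\<close>
  have "?R = prod.swap ` ?L"
    using assms(2) by (force simp: sym_def image_iff)
  then have R: "card ?R = card ?L"
    by (simp add: card_image)
  have "?E = (\<lambda>x. (x, x)) ` {x. (x, x) \<in> S}" by auto
  then have E: "card ?E = card {x. (x, x) \<in> S}"
    by (simp add: card_image inj_on_def)
  have "S = ?L \<union> (?R \<union> ?E)" by auto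
  then have "card S = card (?L \<union> (?R \<union> ?E))" by simp
  also have "\<dots> = card ?L + card (?R \<union> ?E)"
    using fin by (intro card_Un_disjoint) auto
  also have "card (?R \<union> ?E) = card ?R + card ?E"
    using fin by (intro card_Un_disjoint) auto
  finally show ?thesis using R E by simp
qed

lemma harary_index_divisor_prime_graph:
  assumes "n > 0"
  defines "D \<equiv> real (card {d. d dvd n})"
  shows "harary_index (with_proj (divisor_prime_graph n)) =
    (D * (D - 1) + real (card (coprime_divisor_pairs n)) - 1) / 4"
proof -
  let ?V = "{d. d dvd n}"
  let ?T = "{(x, y) \<in> ?V \<times> ?V. x < y}" and ?C = "{(x, y) \<in> coprime_divisor_pairs n. x < y}"
  have finV: "finite ?V" using assms(1) by simp
  have finT: "finite ?T" by (rule finite_subset[of _ "?V \<times> ?V"]) (use finV in auto)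
  have CT: "?C \<subseteq> ?T" by (auto simp: coprime_divisor_pairs_def)
  have "harary_index (with_proj (divisor_prime_graph n)) =
      (\<Sum>(u, v)\<in>?T. 1 / graph_dist (with_proj (divisor_prime_graph n)) u v)"
    unfolding harary_index_def by (intro sum.cong) (auto simp: divisor_prime_graph_def)
  \<comment> \<open>Reciprocal distances are 1 or 1/2: every pair gives 1/2, and a coprime pair
    another 1/2.\<close>
  also have "\<dots> = (\<Sum>z\<in>?T. 1 / 2 + (if z \<in> ?C then 1 / 2 else 0))"
    using assms(1)
    by (intro sum.cong)
      (auto simp: graph_dist_divisor_prime_graph coprime_divisor_pairs_def split: if_splits)
  also have "\<dots> = (\<Sum>z\<in>?T. 1 / 2) + (\<Sum>z\<in>?T \<inter> ?C. 1 / 2)"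
    by (simp only: sum.distrib sum.inter_restrict[OF finT])
  also have "\<dots> = real (card ?T) / 2 + real (card (?T \<inter> ?C)) / 2"
    by simp
  also have "?T \<inter> ?C = ?C" using CT by blast
  finally have H: "harary_index (with_proj (divisor_prime_graph n)) =
      real (card ?T) / 2 + real (card ?C) / 2" .
  \<comment> \<open>The diagonal of all pairs has \<open>D\<close> elements, so twice the size of
    \<open>?T\<close> is \<open>D * (D - 1)\<close>.\<close>
  have "card (?V \<times> ?V) = 2 * card ?T + card {x. (x, x) \<in> ?V \<times> ?V}"
    using finV by (intro card_symmetric_pairs) (auto simp: sym_def)
  then have T: "D * D = 2 * real (card ?T) + D"
    unfolding D_def by (simp add: card_cartesian_product flip: of_nat_mult)
  \<comment> \<open>Only 1 is coprime to itself, whence the term -1 in the formula.\<close>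
  have "{x. (x, x) \<in> coprime_divisor_pairs n} = {1}"
    by (auto simp: coprime_divisor_pairs_def)
  then have C: "card (coprime_divisor_pairs n) = 2 * card ?C + 1"
    using card_symmetric_pairs[of "coprime_divisor_pairs n"]
      finite_coprime_divisor_pairs[OF assms(1)]
    by (simp add: sym_def coprime_divisor_pairs_def coprime_commute)
  show ?thesis
    using T unfolding H C by (simp add: field_simps)
qed

theorem theorem3p2:
  fixes n r D :: nat and p k :: "nat \<Rightarrow> nat"
  assumes "n > 0"
    and "inj_on p {1..r}"
    and "\<And>i. i \<in> {1..r} \<Longrightarrow> prime (p i)"
    and "\<And>i. i \<in> {1..r} \<Longrightarrow> k i \<ge> 1"
    and "n = (\<Prod>i = 1..r. p i ^ k i)"
    and "D = (\<Prod>i = 1..r. (k i + 1))"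
  shows "harary_index (with_proj (divisor_prime_graph n)) =
    (real D * (real D - 1) + (\<Prod>i = 1..r. (2 * real (k i) + 1)) - 1) / 4"
proof -
  have "card {d. d dvd n} = (\<Prod>i = 1..r. card {d. d dvd p i ^ k i})"
    unfolding assms(5)
    by (rule multiplicative_prod_prime_powers) (use assms(2,3) in \<open>auto simp: card_divisors_mult\<close>)
  also have "\<dots> = D"
    unfolding assms(6) using assms(3) by (intro prod.cong) (auto simp: card_divisors_prime_power)
  finally have D: "card {d. d dvd n} = D" .
  \<comment> \<open>Gives the value 1 at the empty product, the base of the induction over the
    primes.\<close>
  have "coprime_divisor_pairs 1 = {(1, 1)}"
    by (auto simp: coprime_divisor_pairs_def)
  then have "card (coprime_divisor_pairs n) = (\<Prod>i = 1..r. card (coprime_divisor_pairs (p i ^ k i)))"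
    unfolding assms(5)
    by (intro multiplicative_prod_prime_powers)
      (use assms(2,3) in \<open>auto simp: card_coprime_divisor_pairs_mult\<close>)
  also have "\<dots> = (\<Prod>i = 1..r. 2 * k i + 1)"
    using assms(3) by (intro prod.cong) (auto simp: card_coprime_divisor_pairs_prime_power)
  finally have "real (card (coprime_divisor_pairs n)) = (\<Prod>i = 1..r. 2 * real (k i) + 1)"
    by (simp add: add.commute)
  then show ?thesis
    using harary_index_divisor_prime_graph[OF assms(1)] D by simp
qed

end
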